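(* Let $(A_1,\cdot_1,[\cdot,\cdot,\cdot]_1)$ be a (finite-dimensional) Poisson 3-Lie algebra and $(A_2,\cdot_2)$ a (finite-dimensional) commutative associative algebra over a field $\mathbb F$ of characteristic zero. For $x_i\in A_1$, $y_i\in A_2$, define linear maps $\cdot_{A_1\otimes A_2}:\otimes^2(A_1\otimes A_2)\to A_1\otimes A_2$ and $[\cdot,\cdot,\cdot]_{A_1\otimes A_2}:\otimes^3(A_1\otimes A_2)\to A_1\otimes A_2$ by $$(x_1\otimes y_1)\cdot_{A_1\otimes A_2}(x_2\otimes y_2)=(x_1\cdot_1x_2)\otimes(y_1\cdot_2y_2),$$ $$[x_1\otimes y_1,x_2\otimes y_2,x_3\otimes y_3]_{A_1\otimes A_2}=[x_1,x_2,x_3]_1\otimes(y_1\cdot_2y_2\cdot_2y_3).$$ Then $(A_1\otimes A_2,\cdot_{A_1\otimes A_2},[\cdot,\cdot,\cdot]_{A_1\otimes A_2})$ is a Poisson 3-Lie algebra.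
   Context: A 3-Lie algebra is a vector space with a skew-symmetric trilinear bracket satisfying $[x_1,x_2,[x_3,x_4,x_5]]=[[x_1,x_2,x_3],x_4,x_5]+[x_3,[x_1,x_2,x_4],x_5]+[x_3,x_4,[x_1,x_2,x_5]]$. A Poisson 3-Lie algebra is a triple $(A,\cdot,[\cdot,\cdot,\cdot])$ where $(A,\cdot)$ is a commutative associative algebra (no unit assumed), $(A,[\cdot,\cdot,\cdot])$ is a 3-Lie algebra, and $[w\cdot x,y,z]=w\cdot[x,y,z]+x\cdot[w,y,z]$ for all $x,y,z,w\in A$. *)

theory Defs
  imports "HOL-Algebra.AbelCoset" "Jordan_Normal_Form.Missing_VectorSpace"
begin

text \<open>
  Vector spaces are those of \<^locale>\<open>vectorspace\<close>: records of type \<^typ>\<open>('f, 'a) module\<close> over a field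
  record. Such a record has fields \<^const>\<open>mult\<close> and \<^const>\<open>one\<close>, which \<^locale>\<open>vectorspace\<close> leaves
  unconstrained. They are never used here: the products of (non-unital) algebras are separate
  parameters.
\<close>

definition char_zero :: "('f, 'r) ring_scheme \<Rightarrow> bool" where
  "char_zero F \<longleftrightarrow> (\<forall>n::nat. 0 < n \<longrightarrow> [n] \<cdot>\<^bsub>F\<^esub> \<one>\<^bsub>F\<^esub> \<noteq> \<zero>\<^bsub>F\<^esub>)"

definition bilinear_map ::
  "('f, 'r) ring_scheme \<Rightarrow> ('f, 'a, 'm) module_scheme \<Rightarrow> ('f, 'b, 'n) module_scheme \<Rightarrow>
   ('f, 'c, 'k) module_scheme \<Rightarrow> ('a \<Rightarrow> 'b \<Rightarrow> 'c) \<Rightarrow> bool" where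
  "bilinear_map F U V W f \<longleftrightarrow>
     (\<forall>v\<in>carrier V. (\<lambda>u. f u v) \<in> module_hom F U W) \<and>
     (\<forall>u\<in>carrier U. (\<lambda>v. f u v) \<in> module_hom F V W)"

definition trilinear_map ::
  "('f, 'r) ring_scheme \<Rightarrow> ('f, 'a, 'm) module_scheme \<Rightarrow> ('f, 'b, 'n) module_scheme \<Rightarrow>
   ('f, 'c, 'k) module_scheme \<Rightarrow> ('f, 'd, 'l) module_scheme \<Rightarrow> ('a \<Rightarrow> 'b \<Rightarrow> 'c \<Rightarrow> 'd) \<Rightarrow> bool" where
  "trilinear_map F U V W Z f \<longleftrightarrow>
     (\<forall>v\<in>carrier V. \<forall>w\<in>carrier W. (\<lambda>u. f u v w) \<in> module_hom F U Z) \<and>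
     (\<forall>u\<in>carrier U. \<forall>w\<in>carrier W. (\<lambda>v. f u v w) \<in> module_hom F V Z) \<and>
     (\<forall>u\<in>carrier U. \<forall>v\<in>carrier V. (\<lambda>w. f u v w) \<in> module_hom F W Z)"


section \<open>Poisson 3-Lie algebras\<close>

locale comm_assoc_algebra = vectorspace F A
  for F :: "('f, 'r) ring_scheme" and A :: "('f, 'a, 'm) module_scheme" +
  fixes mul :: "'a \<Rightarrow> 'a \<Rightarrow> 'a"
  assumes mul_bilinear: "bilinear_map F A A A mul"
    and mul_comm: "\<lbrakk>x \<in> carrier A; y \<in> carrier A\<rbrakk> \<Longrightarrow> mul x y = mul y x"
    and mul_assoc: "\<lbrakk>x \<in> carrier A; y \<in> carrier A; z \<in> carrier A\<rbrakk> \<Longrightarrow>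
      mul (mul x y) z = mul x (mul y z)"

text \<open>
  Skew-symmetry is required for the two adjacent transpositions, which generate all permutations
  of the three arguments.
\<close>

locale three_lie_algebra = vectorspace F A
  for F :: "('f, 'r) ring_scheme" and A :: "('f, 'a, 'm) module_scheme" +
  fixes br :: "'a \<Rightarrow> 'a \<Rightarrow> 'a \<Rightarrow> 'a"
  assumes br_trilinear: "trilinear_map F A A A A br"
    and br_skew12: "\<lbrakk>x \<in> carrier A; y \<in> carrier A; z \<in> carrier A\<rbrakk> \<Longrightarrow>
      br y x z = \<ominus>\<^bsub>A\<^esub> br x y z"
    and br_skew23: "\<lbrakk>x \<in> carrier A; y \<in> carrier A; z \<in> carrier A\<rbrakk> \<Longrightarrow>
      br x z y = \<ominus>\<^bsub>A\<^esub> br x y z"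
    and fundamental_identity:
      "\<lbrakk>x1 \<in> carrier A; x2 \<in> carrier A; x3 \<in> carrier A; x4 \<in> carrier A; x5 \<in> carrier A\<rbrakk> \<Longrightarrow>
       br x1 x2 (br x3 x4 x5) =
         br (br x1 x2 x3) x4 x5 \<oplus>\<^bsub>A\<^esub> br x3 (br x1 x2 x4) x5 \<oplus>\<^bsub>A\<^esub> br x3 x4 (br x1 x2 x5)"

locale poisson_three_lie_algebra = comm_assoc_algebra F A mul + three_lie_algebra F A br
  for F :: "('f, 'r) ring_scheme" and A :: "('f, 'a, 'm) module_scheme"
    and mul :: "'a \<Rightarrow> 'a \<Rightarrow> 'a" and br :: "'a \<Rightarrow> 'a \<Rightarrow> 'a \<Rightarrow> 'a" +
  assumes leibniz:
    "\<lbrakk>w \<in> carrier A; x \<in> carrier A; y \<in> carrier A; z \<in> carrier A\<rbrakk> \<Longrightarrow>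
     br (mul w x) y z = mul w (br x y z) \<oplus>\<^bsub>A\<^esub> mul x (br w y z)"


section \<open>Tensor products\<close>

text \<open>
  The tensor product is the free vector space on \<open>carrier U \<times> carrier V\<close> (finitely supported
  functions) modulo the span of the bilinearity relations; its elements are cosets.
\<close>

definition free_vectorspace :: "('f, 'r) ring_scheme \<Rightarrow> 'x set \<Rightarrow> ('f, 'x \<Rightarrow> 'f) module" where
  "free_vectorspace F X =
     (ring.func_space F X)\<lparr>carrier := {f \<in> X \<rightarrow>\<^sub>E carrier F. finite {x \<in> X. f x \<noteq> \<zero>\<^bsub>F\<^esub>}}\<rparr>"

definition free_generator :: "('f, 'r) ring_scheme \<Rightarrow> 'x set \<Rightarrow> 'x \<Rightarrow> ('x \<Rightarrow> 'f)" where
  "free_generator F X p = (\<lambda>q\<in>X. if q = p then \<one>\<^bsub>F\<^esub> else \<zero>\<^bsub>F\<^esub>)"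

text \<open>
  In the scalar multiplication, adding \<open>N\<close> turns \<open>c \<odot> (N + v)\<close> into the full coset \<open>N + c \<odot> v\<close>
  also when \<open>c = 0\<close>.
\<close>

definition quotient_module :: "('f, 'a, 'm) module_scheme \<Rightarrow> 'a set \<Rightarrow> ('f, 'a set) module" where
  "quotient_module M N =
     \<lparr>carrier = a_rcosets\<^bsub>M\<^esub> N,
      mult = (\<lambda>_ _. N), one = N,
      zero = N,
      add = (\<lambda>S T. S <+>\<^bsub>M\<^esub> T),
      smult = (\<lambda>c S. N <+>\<^bsub>M\<^esub> ((\<lambda>v. c \<odot>\<^bsub>M\<^esub> v) ` S))\<rparr>"

definition tensor_free ::
  "('f, 'r) ring_scheme \<Rightarrow> ('f, 'a, 'm) module_scheme \<Rightarrow> ('f, 'b, 'n) module_scheme \<Rightarrow>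
   ('f, 'a \<times> 'b \<Rightarrow> 'f) module" where
  "tensor_free F U V = free_vectorspace F (carrier U \<times> carrier V)"

definition tensor_gen ::
  "('f, 'r) ring_scheme \<Rightarrow> ('f, 'a, 'm) module_scheme \<Rightarrow> ('f, 'b, 'n) module_scheme \<Rightarrow>
   'a \<Rightarrow> 'b \<Rightarrow> ('a \<times> 'b \<Rightarrow> 'f)" where
  "tensor_gen F U V x y = free_generator F (carrier U \<times> carrier V) (x, y)"

definition tensor_relations ::
  "('f, 'r) ring_scheme \<Rightarrow> ('f, 'a, 'm) module_scheme \<Rightarrow> ('f, 'b, 'n) module_scheme \<Rightarrow>
   ('a \<times> 'b \<Rightarrow> 'f) set" where
  "tensor_relations F U V =
     (let P = tensor_free F U V; g = tensor_gen F U V in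
      {g (x \<oplus>\<^bsub>U\<^esub> x') y \<ominus>\<^bsub>P\<^esub> (g x y \<oplus>\<^bsub>P\<^esub> g x' y) | x x' y.
         x \<in> carrier U \<and> x' \<in> carrier U \<and> y \<in> carrier V} \<union>
      {g x (y \<oplus>\<^bsub>V\<^esub> y') \<ominus>\<^bsub>P\<^esub> (g x y \<oplus>\<^bsub>P\<^esub> g x y') | x y y'.
         x \<in> carrier U \<and> y \<in> carrier V \<and> y' \<in> carrier V} \<union>
      {g (c \<odot>\<^bsub>U\<^esub> x) y \<ominus>\<^bsub>P\<^esub> (c \<odot>\<^bsub>P\<^esub> g x y) | c x y.
         c \<in> carrier F \<and> x \<in> carrier U \<and> y \<in> carrier V} \<union>
      {g x (c \<odot>\<^bsub>V\<^esub> y) \<ominus>\<^bsub>P\<^esub> (c \<odot>\<^bsub>P\<^esub> g x y) | c x y.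
         c \<in> carrier F \<and> x \<in> carrier U \<and> y \<in> carrier V})"

definition tensor_kernel ::
  "('f, 'r) ring_scheme \<Rightarrow> ('f, 'a, 'm) module_scheme \<Rightarrow> ('f, 'b, 'n) module_scheme \<Rightarrow>
   ('a \<times> 'b \<Rightarrow> 'f) set" where
  "tensor_kernel F U V = module.span F (tensor_free F U V) (tensor_relations F U V)"

definition tensor_product ::
  "('f, 'r) ring_scheme \<Rightarrow> ('f, 'a, 'm) module_scheme \<Rightarrow> ('f, 'b, 'n) module_scheme \<Rightarrow>
   ('f, ('a \<times> 'b \<Rightarrow> 'f) set) module" where
  "tensor_product F U V = quotient_module (tensor_free F U V) (tensor_kernel F U V)"

definition pure_tensor ::
  "('f, 'r) ring_scheme \<Rightarrow> ('f, 'a, 'm) module_scheme \<Rightarrow> ('f, 'b, 'n) module_scheme \<Rightarrow>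
   'a \<Rightarrow> 'b \<Rightarrow> ('a \<times> 'b \<Rightarrow> 'f) set" where
  "pure_tensor F U V x y = tensor_kernel F U V +>\<^bsub>tensor_free F U V\<^esub> tensor_gen F U V x y"


section \<open>Induced operations on the tensor product\<close>

text \<open>
  A linear map on \<open>\<otimes>\<^sup>2T\<close> (\<open>\<otimes>\<^sup>3T\<close>) is given as a bilinear (trilinear) map on \<open>T\<close>. Its values outside
  the carrier of \<open>T\<close> are unconstrained.
\<close>

definition is_tensor_mult ::
  "('f, 'r) ring_scheme \<Rightarrow> ('f, 'a, 'm) module_scheme \<Rightarrow> ('f, 'b, 'n) module_scheme \<Rightarrow>
   ('a \<Rightarrow> 'a \<Rightarrow> 'a) \<Rightarrow> ('b \<Rightarrow> 'b \<Rightarrow> 'b) \<Rightarrow>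
   (('a \<times> 'b \<Rightarrow> 'f) set \<Rightarrow> ('a \<times> 'b \<Rightarrow> 'f) set \<Rightarrow> ('a \<times> 'b \<Rightarrow> 'f) set) \<Rightarrow> bool" where
  "is_tensor_mult F A1 A2 mul1 mul2 mul \<longleftrightarrow>
     bilinear_map F (tensor_product F A1 A2) (tensor_product F A1 A2) (tensor_product F A1 A2) mul \<and>
     (\<forall>x1\<in>carrier A1. \<forall>x2\<in>carrier A1. \<forall>y1\<in>carrier A2. \<forall>y2\<in>carrier A2.
        mul (pure_tensor F A1 A2 x1 y1) (pure_tensor F A1 A2 x2 y2) =
          pure_tensor F A1 A2 (mul1 x1 x2) (mul2 y1 y2))"

definition is_tensor_bracket ::
  "('f, 'r) ring_scheme \<Rightarrow> ('f, 'a, 'm) module_scheme \<Rightarrow> ('f, 'b, 'n) module_scheme \<Rightarrow>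
   ('a \<Rightarrow> 'a \<Rightarrow> 'a \<Rightarrow> 'a) \<Rightarrow> ('b \<Rightarrow> 'b \<Rightarrow> 'b) \<Rightarrow>
   (('a \<times> 'b \<Rightarrow> 'f) set \<Rightarrow> ('a \<times> 'b \<Rightarrow> 'f) set \<Rightarrow> ('a \<times> 'b \<Rightarrow> 'f) set \<Rightarrow>
    ('a \<times> 'b \<Rightarrow> 'f) set) \<Rightarrow> bool" where
  "is_tensor_bracket F A1 A2 br1 mul2 br \<longleftrightarrow>
     trilinear_map F (tensor_product F A1 A2) (tensor_product F A1 A2) (tensor_product F A1 A2)
       (tensor_product F A1 A2) br \<and>
     (\<forall>x1\<in>carrier A1. \<forall>x2\<in>carrier A1. \<forall>x3\<in>carrier A1.
      \<forall>y1\<in>carrier A2. \<forall>y2\<in>carrier A2. \<forall>y3\<in>carrier A2.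
        br (pure_tensor F A1 A2 x1 y1) (pure_tensor F A1 A2 x2 y2) (pure_tensor F A1 A2 x3 y3) =
          pure_tensor F A1 A2 (br1 x1 x2 x3) (mul2 (mul2 y1 y2) y3))"

end

theory Submission
  imports Defs
begin

text \<open>
  The operations come from the universal property of \<open>A\<^sub>1 \<otimes> A\<^sub>2\<close>, applied to one argument at a
  time; bilinear and trilinear maps on the tensor product are determined by their values on pure
  tensors. Every axiom is an identity between multilinear maps, so it suffices to check it on pure
  tensors. There the second factors of all terms are the same product in \<open>A\<^sub>2\<close>, by commutativity and
  associativity, and the identity reduces to the corresponding axiom of \<open>A\<^sub>1\<close>.
\<close>

section \<open>Module homomorphisms\<close>

text \<open>The universal property yields linear maps out of a single copy of \<open>T\<close>,
  while the operations have two or three arguments. No tensor power of \<open>T\<close> is formed;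
  the lifts are curried: a lift in the later arguments is the bilinear map that is lifted in the
  first one. This works only if a lift depends linearly on every parameter of the map being lifted.
  The choice of coset representatives is dealt with once, for linear maps; the operations inherit
  well-definedness from it.

  All operations are total functions on a type, so linearity and equality are relative to carriers,
  and membership conditions accompany every argument.

  Uniqueness on pure tensors is needed for at most three arguments at once. Longer identities are
  split: the Leibniz rule as one plus three arguments, the fundamental identity as two plus
  three.\<close>

lemma module_homI:
  assumes "\<And>x. x \<in> carrier M \<Longrightarrow> f x \<in> carrier N"
    and "\<And>x y. \<lbrakk>x \<in> carrier M; y \<in> carrier M\<rbrakk> \<Longrightarrow> f (x \<oplus>\<^bsub>M\<^esub> y) = f x \<oplus>\<^bsub>N\<^esub> f y"
    and "\<And>c x. \<lbrakk>c \<in> carrier R; x \<in> carrier M\<rbrakk> \<Longrightarrow> f (c \<odot>\<^bsub>M\<^esub> x) = c \<odot>\<^bsub>N\<^esub> f x"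
  shows "f \<in> module_hom R M N"
  using assms by (auto simp: module_hom_def)

lemma module_hom_in_carrier:
  "\<lbrakk>f \<in> module_hom R M N; x \<in> carrier M\<rbrakk> \<Longrightarrow> f x \<in> carrier N"
  by (auto simp: module_hom_def)

text \<open>Linearity only concerns values on the carrier. The module structure of \<open>M\<close>
  keeps sums and multiples inside the carrier, where \<open>f\<close> may be replaced by
  \<open>g\<close>. This is used for lifts, whose closed formulas hold only for parameters in a
  carrier.\<close>

lemma module_hom_cong:
  assumes "f \<in> module_hom R M N" "\<And>x. x \<in> carrier M \<Longrightarrow> f x = g x" "module R M"
  shows "g \<in> module_hom R M N"
proof -
  interpret M: module R M by fact
  show ?thesis
    by (rule module_homI)
      (simp_all add: assms(2)[symmetric] module_hom_in_carrier[OF assms(1)]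
        module_hom_add[OF assms(1)] module_hom_smult[OF assms(1)])
qed

lemma module_hom_ident: "(\<lambda>x. x) \<in> module_hom R M M"
  by (auto simp: module_hom_def)

lemma module_hom_comp:
  "\<lbrakk>g \<in> module_hom R N K; f \<in> module_hom R M N\<rbrakk> \<Longrightarrow> (\<lambda>x. g (f x)) \<in> module_hom R M K"
  by (auto simp: module_hom_def Pi_iff)

lemma (in module) module_hom_plus:
  assumes "f \<in> module_hom R L M" "g \<in> module_hom R L M"
  shows "(\<lambda>x. f x \<oplus>\<^bsub>M\<^esub> g x) \<in> module_hom R L M"
  using assms by (auto simp: module_hom_def Pi_iff smult_r_distr M.a_ac)

text \<open>Homogeneity needs \<open>c\<close> to commute with the other scalar, hence the
  commutative base ring.\<close>

lemma (in module) module_hom_scale: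
  assumes "f \<in> module_hom R L M" "c \<in> carrier R"
  shows "(\<lambda>x. c \<odot>\<^bsub>M\<^esub> f x) \<in> module_hom R L M"
  using assms by (auto simp: module_hom_def Pi_iff smult_r_distr smult_assoc1[symmetric] R.m_comm)

lemma (in module) module_hom_minus:
  assumes "f \<in> module_hom R L M"
  shows "(\<lambda>x. \<ominus>\<^bsub>M\<^esub> f x) \<in> module_hom R L M"
proof -
  have "(\<ominus> \<one>) \<odot>\<^bsub>M\<^esub> f x = \<ominus>\<^bsub>M\<^esub> f x" if "x \<in> carrier L" for x
    using module_hom_in_carrier[OF assms that] by (simp add: smult_minus_1)
  then show ?thesis
    using module_hom_scale[OF assms, of "\<ominus> \<one>"] assms
    by (auto simp: module_hom_def Pi_iff smult_r_minus smult_minus_1 M.minus_add)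
qed

section \<open>Free modules\<close>

context cring
begin

text \<open>Seeing the finitely supported functions as a submodule of all functions lets the free
  module inherit its module axioms.\<close>

lemma free_submodule:
  "submodule R {f \<in> X \<rightarrow>\<^sub>E carrier R. finite {x \<in> X. f x \<noteq> \<zero>}} (func_space X)"
proof (rule submodule.intro[OF func_space_is_module])
  let ?C = "{f \<in> X \<rightarrow>\<^sub>E carrier R. finite {x \<in> X. f x \<noteq> \<zero>}}"
  show "?C \<subseteq> carrier (func_space X)" "\<zero>\<^bsub>func_space X\<^esub> \<in> ?C"
    by (auto simp: func_space_def)
  fix f g
  assume f: "f \<in> ?C"
  { assume g: "g \<in> ?C"
    have "finite {x \<in> X. f x \<oplus> g x \<noteq> \<zero>}"
      by (rule finite_subset[of _ "{x \<in> X. f x \<noteq> \<zero>} \<union> {x \<in> X. g x \<noteq> \<zero>}"]) (use f g in auto)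
    then show "f \<oplus>\<^bsub>func_space X\<^esub> g \<in> ?C"
      using f g by (auto simp: func_space_def PiE_mem cong: conj_cong) }
  { fix c assume c: "c \<in> carrier R"
    have "finite {x \<in> X. c \<otimes> f x \<noteq> \<zero>}"
      by (rule finite_subset[of _ "{x \<in> X. f x \<noteq> \<zero>}"]) (use f c in auto)
    then show "c \<odot>\<^bsub>func_space X\<^esub> f \<in> ?C"
      using f c by (auto simp: func_space_def PiE_mem cong: conj_cong) }
qed

lemma free_module: "module R (free_vectorspace R X)"
  unfolding free_vectorspace_def
  using module.submodule_is_module[OF func_space_is_module free_submodule] .

lemma free_simps:
  "carrier (free_vectorspace R X) = {f \<in> X \<rightarrow>\<^sub>E carrier R. finite {x \<in> X. f x \<noteq> \<zero>}}"
  "f \<oplus>\<^bsub>free_vectorspace R X\<^esub> g = (\<lambda>x\<in>X. f x \<oplus> g x)"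
  "c \<odot>\<^bsub>free_vectorspace R X\<^esub> f = (\<lambda>x\<in>X. c \<otimes> f x)"
  "\<zero>\<^bsub>free_vectorspace R X\<^esub> = (\<lambda>x\<in>X. \<zero>)"
  by (simp_all add: free_vectorspace_def func_space_def)

lemma free_generator_closed:
  "free_generator R X p \<in> carrier (free_vectorspace R X)"
  by (auto simp: free_simps free_generator_def intro: finite_subset[of _ "{p}"])

text \<open>Induction on the support: removing one point splits off a multiple of a generator. Later
  spanning arguments use this rule and so avoid explicit finite sums.\<close>

lemma free_induct [consumes 1, case_names zero gen add smult]:
  assumes f: "f \<in> carrier (free_vectorspace R X)"
    and zero: "P \<zero>\<^bsub>free_vectorspace R X\<^esub>"
    and gen: "\<And>p. p \<in> X \<Longrightarrow> P (free_generator R X p)"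
    and add: "\<And>g h. \<lbrakk>g \<in> carrier (free_vectorspace R X); h \<in> carrier (free_vectorspace R X);
      P g; P h\<rbrakk> \<Longrightarrow> P (g \<oplus>\<^bsub>free_vectorspace R X\<^esub> h)"
    and smult: "\<And>c g. \<lbrakk>c \<in> carrier R; g \<in> carrier (free_vectorspace R X); P g\<rbrakk> \<Longrightarrow>
      P (c \<odot>\<^bsub>free_vectorspace R X\<^esub> g)"
  shows "P f"
proof -
  interpret P: module R "free_vectorspace R X" by (rule free_module)
  have "finite {x \<in> X. f x \<noteq> \<zero>}"
    using f by (simp add: free_simps)
  moreover have "P f" if "finite S" "f \<in> carrier (free_vectorspace R X)" "{x \<in> X. f x \<noteq> \<zero>} = S" for S f
    using that
  proof (induction S arbitrary: f rule: finite_induct)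
    case empty
    then have "f = \<zero>\<^bsub>free_vectorspace R X\<^esub>"
      by (auto simp: free_simps fun_eq_iff PiE_def extensional_def)
    with zero show ?case by simp
  next
    case (insert p S)
    then have p: "p \<in> X" by auto
    have fX: "f x \<in> carrier R" if "x \<in> X" for x
      using insert.prems that by (auto simp: free_simps)
    \<comment> \<open>\<open>g\<close> is \<open>f\<close> with its value at \<open>p\<close>
      erased, so its support is exactly \<open>S\<close> and \<open>f\<close> is \<open>f p\<close>
      times the generator at \<open>p\<close>, plus \<open>g\<close>.\<close>
    define g where "g = (\<lambda>x\<in>X. if x = p then \<zero> else f x)"
    have sg: "{x \<in> X. g x \<noteq> \<zero>} = S"
      using insert by (auto simp: g_def)
    then have g: "g \<in> carrier (free_vectorspace R X)"
      using insert.hyps(1) fX by (auto simp: free_simps g_def)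
    have "f = f p \<odot>\<^bsub>free_vectorspace R X\<^esub> free_generator R X p \<oplus>\<^bsub>free_vectorspace R X\<^esub> g"
      using insert.prems(1) fX p
      by (auto simp: free_simps free_generator_def g_def fun_eq_iff PiE_def extensional_def)
    moreover have "P \<dots>"
      using insert.IH[OF g sg] g p fX by (intro add smult gen P.smult_closed free_generator_closed)
    ultimately show ?case by simp
  qed
  ultimately show ?thesis
    using f by blast
qed

end

text \<open>The linear extension of \<open>b\<close>. The sum runs over the support, which is finite
  for elements of the free module; a sum over an infinite \<open>X\<close> would collapse to the
  default value zero.\<close>

definition free_lift ::
  "('f, 'r) ring_scheme \<Rightarrow> 'x set \<Rightarrow> ('f, 'c, 'k) module_scheme \<Rightarrow> ('x \<Rightarrow> 'c) \<Rightarrow> ('x \<Rightarrow> 'f) \<Rightarrow> 'c"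
  where "free_lift R X W b f = (\<Oplus>\<^bsub>W\<^esub>p\<in>{p \<in> X. f p \<noteq> \<zero>\<^bsub>R\<^esub>}. f p \<odot>\<^bsub>W\<^esub> b p)"

context module
begin

text \<open>Points outside the support contribute zero, so functions with different supports can be
  summed over one common index set.\<close>

lemma free_lift_superset:
  assumes "b \<in> X \<rightarrow> carrier M" "f \<in> X \<rightarrow> carrier R" "finite S" "S \<subseteq> X" "{p \<in> X. f p \<noteq> \<zero>} \<subseteq> S"
  shows "free_lift R X M b f = (\<Oplus>\<^bsub>M\<^esub>p\<in>S. f p \<odot>\<^bsub>M\<^esub> b p)"
  unfolding free_lift_def
  by (rule M.add.finprod_mono_neutral_cong_left) (use assms in \<open>auto simp: Pi_iff subset_iff\<close>)

lemma free_lift_hom: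
  assumes b: "b \<in> X \<rightarrow> carrier M"
  shows "free_lift R X M b \<in> module_hom R (free_vectorspace R X) M"
proof (rule module_homI)
  fix f assume f: "f \<in> carrier (free_vectorspace R X)"
  then have fX: "f \<in> X \<rightarrow> carrier R" and ff: "finite {p \<in> X. f p \<noteq> \<zero>}"
    by (auto simp: R.free_simps)
  show "free_lift R X M b f \<in> carrier M"
    unfolding free_lift_def by (rule M.finsum_closed) (use b fX in \<open>auto simp: Pi_iff\<close>)
  { fix g assume g: "g \<in> carrier (free_vectorspace R X)"
    then have gX: "g \<in> X \<rightarrow> carrier R" and gf: "finite {p \<in> X. g p \<noteq> \<zero>}"
      by (auto simp: R.free_simps)
    \<comment> \<open>Cancellation can make the support of the sum smaller than this union, which
      still serves as index set for all three sums.\<close>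
    let ?S = "{p \<in> X. f p \<noteq> \<zero>} \<union> {p \<in> X. g p \<noteq> \<zero>}"
    have S: "finite ?S" "?S \<subseteq> X"
      using ff gf by auto
    have "free_lift R X M b (f \<oplus>\<^bsub>free_vectorspace R X\<^esub> g) = (\<Oplus>\<^bsub>M\<^esub>p\<in>?S. (\<lambda>x\<in>X. f x \<oplus> g x) p \<odot>\<^bsub>M\<^esub> b p)"
      unfolding R.free_simps by (rule free_lift_superset[OF b _ S]) (use fX gX in auto)
    also have "\<dots> = (\<Oplus>\<^bsub>M\<^esub>p\<in>?S. f p \<odot>\<^bsub>M\<^esub> b p \<oplus>\<^bsub>M\<^esub> g p \<odot>\<^bsub>M\<^esub> b p)"
      by (rule M.finsum_cong') (use b fX gX in \<open>auto simp: Pi_iff smult_l_distr\<close>)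
    also have "\<dots> = (\<Oplus>\<^bsub>M\<^esub>p\<in>?S. f p \<odot>\<^bsub>M\<^esub> b p) \<oplus>\<^bsub>M\<^esub> (\<Oplus>\<^bsub>M\<^esub>p\<in>?S. g p \<odot>\<^bsub>M\<^esub> b p)"
      by (rule M.finsum_addf) (use b fX gX in \<open>auto simp: Pi_iff\<close>)
    also have "\<dots> = free_lift R X M b f \<oplus>\<^bsub>M\<^esub> free_lift R X M b g"
      using free_lift_superset[OF b fX S] free_lift_superset[OF b gX S] by auto
    finally show "free_lift R X M b (f \<oplus>\<^bsub>free_vectorspace R X\<^esub> g) =
      free_lift R X M b f \<oplus>\<^bsub>M\<^esub> free_lift R X M b g" . }
  { fix c assume c: "c \<in> carrier R"
    \<comment> \<open>The support of the multiple may be smaller, for instance when \<open>c\<close>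
      is zero.\<close>
    let ?S = "{p \<in> X. f p \<noteq> \<zero>}"
    have "free_lift R X M b (c \<odot>\<^bsub>free_vectorspace R X\<^esub> f) = (\<Oplus>\<^bsub>M\<^esub>p\<in>?S. (\<lambda>x\<in>X. c \<otimes> f x) p \<odot>\<^bsub>M\<^esub> b p)"
      unfolding R.free_simps by (rule free_lift_superset[OF b _ ff]) (use fX c in auto)
    also have "\<dots> = (\<Oplus>\<^bsub>M\<^esub>p\<in>?S. c \<odot>\<^bsub>M\<^esub> (f p \<odot>\<^bsub>M\<^esub> b p))"
      by (rule M.finsum_cong') (use b fX c in \<open>auto simp: Pi_iff smult_assoc1\<close>)
    also have "\<dots> = c \<odot>\<^bsub>M\<^esub> free_lift R X M b f"
      unfolding free_lift_def by (rule finsum_smult[symmetric]) (use b fX c in \<open>auto simp: Pi_iff\<close>)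
    finally show "free_lift R X M b (c \<odot>\<^bsub>free_vectorspace R X\<^esub> f) = c \<odot>\<^bsub>M\<^esub> free_lift R X M b f" . }
qed

lemma free_lift_generator:
  assumes b: "b \<in> X \<rightarrow> carrier M" and p: "p \<in> X"
  shows "free_lift R X M b (free_generator R X p) = b p"
proof -
  \<comment> \<open>The singleton only has to contain the support, so no case split is needed for
    the zero ring, where the support is empty.\<close>
  have "free_lift R X M b (free_generator R X p) = (\<Oplus>\<^bsub>M\<^esub>q\<in>{p}. free_generator R X p q \<odot>\<^bsub>M\<^esub> b q)"
    by (rule free_lift_superset[OF b]) (use p in \<open>auto simp: free_generator_def\<close>)
  also have "\<dots> = b p"
    using b p by (simp add: free_generator_def Pi_iff)
  finally show ?thesis .
qed

end

section \<open>Quotient modules\<close>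

text \<open>Evaluation at an arbitrary representative; it is meaningful when \<open>f\<close> is
  constant on each coset.\<close>

definition quotient_lift :: "('a \<Rightarrow> 'b) \<Rightarrow> 'a set \<Rightarrow> 'b" where
  "quotient_lift f S = f (SOME v. v \<in> S)"

context submodule
begin

sublocale M: module R M
  by (rule module)

text \<open>Closure under negation comes from scaling by minus one. The coset calculus of abelian
  groups then applies to \<open>N\<close>.\<close>

lemma abelian_subgroup: "abelian_subgroup N M"
proof (rule abelian_subgroupI3)
  show "additive_subgroup N M"
  proof (rule additive_subgroupI, rule M.M.add.subgroupI)
    fix a assume "a \<in> N"
    then have "(\<ominus>\<^bsub>R\<^esub> \<one>\<^bsub>R\<^esub>) \<odot>\<^bsub>M\<^esub> a \<in> N" "a \<in> carrier M"
      using subset by auto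
    then show "\<ominus>\<^bsub>M\<^esub> a \<in> N"
      by (simp add: M.smult_minus_1)
  qed (use subset zero_closed in \<open>auto simp del: zero_closed\<close>)
qed (rule M.M.abelian_group_axioms)

sublocale N: abelian_subgroup N M
  by (rule abelian_subgroup)

lemma quotient_carrierE:
  assumes "S \<in> carrier (quotient_module M N)"
  obtains v where "v \<in> carrier M" "S = N +>\<^bsub>M\<^esub> v"
  using assms by (auto simp: quotient_module_def A_RCOSETS_def')

lemma quotient_add:
  "\<lbrakk>v \<in> carrier M; w \<in> carrier M\<rbrakk> \<Longrightarrow>
    (N +>\<^bsub>M\<^esub> v) \<oplus>\<^bsub>quotient_module M N\<^esub> (N +>\<^bsub>M\<^esub> w) = N +>\<^bsub>M\<^esub> (v \<oplus>\<^bsub>M\<^esub> w)"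
  by (simp add: quotient_module_def N.a_rcos_sum)

text \<open>In one direction n + c(m + v) = (n + cm) + cv, and n + cm lies in \<open>N\<close>. In
  the other, \<open>v\<close> itself is taken as the element of its coset, so that the added copy of
  \<open>N\<close> supplies all of the coset of cv.\<close>

lemma quotient_smult:
  assumes c: "c \<in> carrier R" and v: "v \<in> carrier M"
  shows "c \<odot>\<^bsub>quotient_module M N\<^esub> (N +>\<^bsub>M\<^esub> v) = N +>\<^bsub>M\<^esub> (c \<odot>\<^bsub>M\<^esub> v)"
proof -
  have NM: "n \<in> N \<Longrightarrow> n \<in> carrier M" for n
    using subset by auto
  have "N <+>\<^bsub>M\<^esub> (\<lambda>v. c \<odot>\<^bsub>M\<^esub> v) ` (N +>\<^bsub>M\<^esub> v) = N +>\<^bsub>M\<^esub> (c \<odot>\<^bsub>M\<^esub> v)"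
  proof (intro equalityI subsetI)
    fix z assume "z \<in> N <+>\<^bsub>M\<^esub> (\<lambda>v. c \<odot>\<^bsub>M\<^esub> v) ` (N +>\<^bsub>M\<^esub> v)"
    then obtain n m where nm: "n \<in> N" "m \<in> N" "z = n \<oplus>\<^bsub>M\<^esub> c \<odot>\<^bsub>M\<^esub> (m \<oplus>\<^bsub>M\<^esub> v)"
      by (auto simp: set_add_def' a_r_coset_def')
    then have "z = (n \<oplus>\<^bsub>M\<^esub> c \<odot>\<^bsub>M\<^esub> m) \<oplus>\<^bsub>M\<^esub> c \<odot>\<^bsub>M\<^esub> v"
      using c v NM by (simp add: M.smult_r_distr M.M.a_assoc)
    moreover have "n \<oplus>\<^bsub>M\<^esub> c \<odot>\<^bsub>M\<^esub> m \<in> N"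
      using nm c by simp
    ultimately show "z \<in> N +>\<^bsub>M\<^esub> (c \<odot>\<^bsub>M\<^esub> v)"
      by (auto simp: a_r_coset_def')
  next
    fix z assume "z \<in> N +>\<^bsub>M\<^esub> (c \<odot>\<^bsub>M\<^esub> v)"
    then obtain n where "n \<in> N" "z = n \<oplus>\<^bsub>M\<^esub> c \<odot>\<^bsub>M\<^esub> v"
      by (auto simp: a_r_coset_def')
    moreover have "v \<in> N +>\<^bsub>M\<^esub> v"
      using v by (rule N.a_rcos_self)
    ultimately show "z \<in> N <+>\<^bsub>M\<^esub> (\<lambda>v. c \<odot>\<^bsub>M\<^esub> v) ` (N +>\<^bsub>M\<^esub> v)"
      by (auto simp: set_add_def')
  qed
  then show ?thesis
    by (simp add: quotient_module_def)
qed

lemma quotient_zero: "\<zero>\<^bsub>quotient_module M N\<^esub> = N +>\<^bsub>M\<^esub> \<zero>\<^bsub>M\<^esub>"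
  using subset by (simp add: quotient_module_def)

lemma quotient_closed: "v \<in> carrier M \<Longrightarrow> N +>\<^bsub>M\<^esub> v \<in> carrier (quotient_module M N)"
  using subset by (simp add: quotient_module_def M.M.a_rcosetsI)

lemma quotient_is_module: "module R (quotient_module M N)"
proof (rule module_criteria, goal_cases)
  case 1
  show ?case by (rule M.R.is_cring)
next
  case 4
  show ?case
  proof
    fix S assume "S \<in> carrier (quotient_module M N)"
    then obtain v where "v \<in> carrier M" "S = N +>\<^bsub>M\<^esub> v" by (rule quotient_carrierE)
    then show "\<exists>T\<in>carrier (quotient_module M N). S \<oplus>\<^bsub>quotient_module M N\<^esub> T = \<zero>\<^bsub>quotient_module M N\<^esub>"
      \<comment> \<open>The additive inverse of a coset is the coset of the negated
        representative.\<close>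
      by (intro bexI[of _ "N +>\<^bsub>M\<^esub> (\<ominus>\<^bsub>M\<^esub> v)"])
        (simp_all add: quotient_add quotient_zero quotient_closed M.M.r_neg)
  qed
qed (auto elim!: quotient_carrierE
       simp: quotient_add quotient_smult quotient_zero quotient_closed M.M.a_ac
         M.smult_assoc1 M.smult_l_distr M.smult_r_distr)

text \<open>The chosen representative is n + v for some n in \<open>N\<close>, and \<open>f\<close>
  kills n.\<close>

lemma quotient_lift_coset:
  assumes W: "module R W" and f: "f \<in> module_hom R M W" and f0: "\<And>v. v \<in> N \<Longrightarrow> f v = \<zero>\<^bsub>W\<^esub>"
    and v: "v \<in> carrier M"
  shows "quotient_lift f (N +>\<^bsub>M\<^esub> v) = f v"
proof -
  interpret W: module R W by fact
  have "(SOME w. w \<in> N +>\<^bsub>M\<^esub> v) \<in> N +>\<^bsub>M\<^esub> v"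
    using N.a_rcos_self[OF v] by (rule someI)
  then obtain n where n: "n \<in> N" "(SOME w. w \<in> N +>\<^bsub>M\<^esub> v) = n \<oplus>\<^bsub>M\<^esub> v"
    by (auto simp: a_r_coset_def')
  moreover have "f (n \<oplus>\<^bsub>M\<^esub> v) = f v"
    using module_hom_add[OF f, of n v] module_hom_in_carrier[OF f v] f0[OF n(1)] n(1) subset v by auto
  ultimately show ?thesis
    by (simp add: quotient_lift_def)
qed

lemma quotient_lift_hom:
  assumes "module R W" "f \<in> module_hom R M W" "\<And>v. v \<in> N \<Longrightarrow> f v = \<zero>\<^bsub>W\<^esub>"
  shows "quotient_lift f \<in> module_hom R (quotient_module M N) W"
  by (rule module_homI; elim quotient_carrierE)
    (simp_all add: quotient_add quotient_smult quotient_lift_coset[OF assms] module_hom_in_carrier[OF assms(2)]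
      module_hom_add[OF assms(2)] module_hom_smult[OF assms(2)])

end


section \<open>The universal property of the tensor product\<close>

lemma bilinear_mapI:
  assumes "\<And>v. v \<in> carrier V \<Longrightarrow> (\<lambda>u. f u v) \<in> module_hom R U W"
    and "\<And>u. u \<in> carrier U \<Longrightarrow> (\<lambda>v. f u v) \<in> module_hom R V W"
  shows "bilinear_map R U V W f"
  using assms by (simp add: bilinear_map_def)

lemma bilinear_mapD:
  assumes "bilinear_map R U V W f"
  shows "v \<in> carrier V \<Longrightarrow> (\<lambda>u. f u v) \<in> module_hom R U W"
    and "u \<in> carrier U \<Longrightarrow> (\<lambda>v. f u v) \<in> module_hom R V W"
  using assms by (simp_all add: bilinear_map_def)

lemma bilinear_map_closed:
  "\<lbrakk>bilinear_map R U V W f; u \<in> carrier U; v \<in> carrier V\<rbrakk> \<Longrightarrow> f u v \<in> carrier W"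
  by (rule module_hom_in_carrier[OF bilinear_mapD(2)])

text \<open>One composition rule per slot, in a shape that allows linearity of a nested expression
  to be derived by following its syntax.\<close>

lemma bilinear_map_homs:
  assumes f: "bilinear_map R U V W f"
  shows "\<lbrakk>g \<in> module_hom R M U; v \<in> carrier V\<rbrakk> \<Longrightarrow> (\<lambda>x. f (g x) v) \<in> module_hom R M W"
    and "\<lbrakk>h \<in> module_hom R M V; u \<in> carrier U\<rbrakk> \<Longrightarrow> (\<lambda>x. f u (h x)) \<in> module_hom R M W"
  subgoal premises p using module_hom_comp[OF bilinear_mapD(1)[OF f p(2)] p(1)] .
  subgoal premises p using module_hom_comp[OF bilinear_mapD(2)[OF f p(2)] p(1)] .
  done

lemma bilinear_map_comp:
  assumes f: "bilinear_map R U' V' W f" and g: "g \<in> module_hom R U U'" and h: "h \<in> module_hom R V V'"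
  shows "bilinear_map R U V W (\<lambda>u v. f (g u) (h v))"
proof (rule bilinear_mapI)
  show "(\<lambda>u. f (g u) (h v)) \<in> module_hom R U W" if "v \<in> carrier V" for v
    by (rule bilinear_map_homs(1)[OF f g module_hom_in_carrier[OF h that]])
  show "(\<lambda>v. f (g u) (h v)) \<in> module_hom R V W" if "u \<in> carrier U" for u
    by (rule bilinear_map_homs(2)[OF f h module_hom_in_carrier[OF g that]])
qed

lemma trilinear_mapI:
  assumes "\<And>v w. \<lbrakk>v \<in> carrier V; w \<in> carrier W\<rbrakk> \<Longrightarrow> (\<lambda>u. f u v w) \<in> module_hom R U Z"
    and "\<And>u w. \<lbrakk>u \<in> carrier U; w \<in> carrier W\<rbrakk> \<Longrightarrow> (\<lambda>v. f u v w) \<in> module_hom R V Z"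
    and "\<And>u v. \<lbrakk>u \<in> carrier U; v \<in> carrier V\<rbrakk> \<Longrightarrow> (\<lambda>w. f u v w) \<in> module_hom R W Z"
  shows "trilinear_map R U V W Z f"
  using assms by (simp add: trilinear_map_def)

lemma trilinear_mapD:
  assumes "trilinear_map R U V W Z f"
  shows "\<lbrakk>v \<in> carrier V; w \<in> carrier W\<rbrakk> \<Longrightarrow> (\<lambda>u. f u v w) \<in> module_hom R U Z"
    and "\<lbrakk>u \<in> carrier U; w \<in> carrier W\<rbrakk> \<Longrightarrow> (\<lambda>v. f u v w) \<in> module_hom R V Z"
    and "\<lbrakk>u \<in> carrier U; v \<in> carrier V\<rbrakk> \<Longrightarrow> (\<lambda>w. f u v w) \<in> module_hom R W Z"
  using assms unfolding trilinear_map_def by blast+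

lemma trilinear_map_closed:
  "\<lbrakk>trilinear_map R U V W Z f; u \<in> carrier U; v \<in> carrier V; w \<in> carrier W\<rbrakk> \<Longrightarrow> f u v w \<in> carrier Z"
  by (rule module_hom_in_carrier[OF trilinear_mapD(3)])

lemma trilinear_map_homs:
  assumes f: "trilinear_map R U V W Z f"
  shows "\<lbrakk>g \<in> module_hom R M U; v \<in> carrier V; w \<in> carrier W\<rbrakk> \<Longrightarrow> (\<lambda>x. f (g x) v w) \<in> module_hom R M Z"
    and "\<lbrakk>h \<in> module_hom R M V; u \<in> carrier U; w \<in> carrier W\<rbrakk> \<Longrightarrow> (\<lambda>x. f u (h x) w) \<in> module_hom R M Z"
    and "\<lbrakk>k \<in> module_hom R M W; u \<in> carrier U; v \<in> carrier V\<rbrakk> \<Longrightarrow> (\<lambda>x. f u v (k x)) \<in> module_hom R M Z"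
  subgoal premises p using module_hom_comp[OF trilinear_mapD(1)[OF f p(2,3)] p(1)] .
  subgoal premises p using module_hom_comp[OF trilinear_mapD(2)[OF f p(2,3)] p(1)] .
  subgoal premises p using module_hom_comp[OF trilinear_mapD(3)[OF f p(2,3)] p(1)] .
  done

section \<open>The tensor product as a module spanned by pure tensors\<close>

locale module_pair = U: module R U + V: module R V
  for R :: "('f, 'r) ring_scheme" and U :: "('f, 'a, 'm) module_scheme" and V :: "('f, 'b, 'n) module_scheme"
begin

abbreviation "T \<equiv> tensor_product R U V"
abbreviation "pure \<equiv> pure_tensor R U V"

lemma tensor_free_module: "module R (tensor_free R U V)"
  unfolding tensor_free_def by (rule U.R.free_module)

lemma tensor_gen_closed: "tensor_gen R U V x y \<in> carrier (tensor_free R U V)"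
  unfolding tensor_free_def tensor_gen_def by (rule U.R.free_generator_closed)

sublocale P: module R "tensor_free R U V"
  by (rule tensor_free_module)

lemma tensor_relations_subset: "tensor_relations R U V \<subseteq> carrier (tensor_free R U V)"
  by (auto simp: tensor_relations_def Let_def tensor_gen_closed)

sublocale K: submodule R "tensor_kernel R U V" "tensor_free R U V"
  unfolding tensor_kernel_def by (rule P.span_is_submodule[OF tensor_relations_subset])

sublocale T: module R T
  unfolding tensor_product_def by (rule K.quotient_is_module)

lemma tensor_relations_kernel: "tensor_relations R U V \<subseteq> tensor_kernel R U V"
  unfolding tensor_kernel_def by (rule P.in_own_span[OF tensor_relations_subset])

lemma pure_closed: "pure x y \<in> carrier T"
  unfolding tensor_product_def pure_tensor_def by (rule K.quotient_closed[OF tensor_gen_closed])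

text \<open>A relation is written as a difference of the two sides of a bilinearity law; this turns
  it into the law itself for cosets.\<close>

lemma kernel_coset_eqI:
  assumes r: "v \<ominus>\<^bsub>tensor_free R U V\<^esub> w \<in> tensor_relations R U V"
    and v: "v \<in> carrier (tensor_free R U V)" and w: "w \<in> carrier (tensor_free R U V)"
  shows "tensor_kernel R U V +>\<^bsub>tensor_free R U V\<^esub> v = tensor_kernel R U V +>\<^bsub>tensor_free R U V\<^esub> w"
proof (rule P.M.a_coset_add_inv1[OF _ v w K.subset])
  show "tensor_kernel R U V +>\<^bsub>tensor_free R U V\<^esub> (v \<oplus>\<^bsub>tensor_free R U V\<^esub> \<ominus>\<^bsub>tensor_free R U V\<^esub> w)
    = tensor_kernel R U V"
    using r tensor_relations_kernel v w
    by (intro P.M.a_coset_join2 K.N.a_subgroup) (auto simp: a_minus_def)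
qed

lemma pure_bilinear: "bilinear_map R U V T pure"
proof (intro bilinear_mapI module_homI)
  note simps = tensor_product_def pure_tensor_def K.quotient_add K.quotient_smult tensor_gen_closed
    P.M.a_closed P.smult_closed
  fix x y assume x: "x \<in> carrier U" and y: "y \<in> carrier V"
  let ?P = "tensor_free R U V" and ?g = "tensor_gen R U V"
  \<comment> \<open>Closure is required once for each slot.\<close>
  show "pure x y \<in> carrier T" "pure x y \<in> carrier T"
    by (rule pure_closed)+
  { fix x' assume x': "x' \<in> carrier U"
    have "?g (x \<oplus>\<^bsub>U\<^esub> x') y \<ominus>\<^bsub>?P\<^esub> (?g x y \<oplus>\<^bsub>?P\<^esub> ?g x' y) \<in> tensor_relations R U V"
      unfolding tensor_relations_def Let_def using x x' y by blast
    then show "pure (x \<oplus>\<^bsub>U\<^esub> x') y = pure x y \<oplus>\<^bsub>T\<^esub> pure x' y"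
      by (simp only: simps) (erule kernel_coset_eqI, simp_all add: tensor_gen_closed) }
  { fix y' assume y': "y' \<in> carrier V"
    have "?g x (y \<oplus>\<^bsub>V\<^esub> y') \<ominus>\<^bsub>?P\<^esub> (?g x y \<oplus>\<^bsub>?P\<^esub> ?g x y') \<in> tensor_relations R U V"
      unfolding tensor_relations_def Let_def using x y y' by blast
    then show "pure x (y \<oplus>\<^bsub>V\<^esub> y') = pure x y \<oplus>\<^bsub>T\<^esub> pure x y'"
      by (simp only: simps) (erule kernel_coset_eqI, simp_all add: tensor_gen_closed) }
  { fix c assume c: "c \<in> carrier R"
    have "?g (c \<odot>\<^bsub>U\<^esub> x) y \<ominus>\<^bsub>?P\<^esub> (c \<odot>\<^bsub>?P\<^esub> ?g x y) \<in> tensor_relations R U V"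
      unfolding tensor_relations_def Let_def using x y c by blast
    then show "pure (c \<odot>\<^bsub>U\<^esub> x) y = c \<odot>\<^bsub>T\<^esub> pure x y"
      using c
      by (simp only: simps) (erule kernel_coset_eqI, simp_all add: tensor_gen_closed)
    have "?g x (c \<odot>\<^bsub>V\<^esub> y) \<ominus>\<^bsub>?P\<^esub> (c \<odot>\<^bsub>?P\<^esub> ?g x y) \<in> tensor_relations R U V"
      unfolding tensor_relations_def Let_def using x y c by blast
    then show "pure x (c \<odot>\<^bsub>V\<^esub> y) = c \<odot>\<^bsub>T\<^esub> pure x y"
      using c
      by (simp only: simps) (erule kernel_coset_eqI, simp_all add: tensor_gen_closed) }
qed

lemmas pure_add = module_hom_add[OF bilinear_mapD(1)[OF pure_bilinear]]
  module_hom_add[OF bilinear_mapD(2)[OF pure_bilinear]]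
lemmas pure_smult = module_hom_smult[OF bilinear_mapD(1)[OF pure_bilinear]]
  module_hom_smult[OF bilinear_mapD(2)[OF pure_bilinear]]

text \<open>Generators of the free module map to pure tensors, so induction there passes to the
  quotient. No case for zero is needed, since zero is a multiple of a pure tensor.\<close>

lemma tensor_induct [consumes 1, case_names pure add smult]:
  assumes t: "t \<in> carrier T"
    and pure: "\<And>x y. \<lbrakk>x \<in> carrier U; y \<in> carrier V\<rbrakk> \<Longrightarrow> Q (pure x y)"
    and add: "\<And>s t. \<lbrakk>s \<in> carrier T; t \<in> carrier T; Q s; Q t\<rbrakk> \<Longrightarrow> Q (s \<oplus>\<^bsub>T\<^esub> t)"
    and smult: "\<And>c t. \<lbrakk>c \<in> carrier R; t \<in> carrier T; Q t\<rbrakk> \<Longrightarrow> Q (c \<odot>\<^bsub>T\<^esub> t)"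
  shows "Q t"
proof -
  let ?coset = "\<lambda>v. tensor_kernel R U V +>\<^bsub>tensor_free R U V\<^esub> v"
  obtain v where v: "v \<in> carrier (tensor_free R U V)" and tv: "t = ?coset v"
    using t unfolding tensor_product_def by (rule K.quotient_carrierE)
  have closed: "w \<in> carrier (tensor_free R U V) \<Longrightarrow> ?coset w \<in> carrier T" for w
    unfolding tensor_product_def by (rule K.quotient_closed)
  have "Q (?coset v)"
    using v unfolding tensor_free_def
  proof (induction rule: U.R.free_induct)
    case zero
    \<comment> \<open>The zero vectors serve merely as elements known to lie in the
      carriers.\<close>
    have "Q (\<zero>\<^bsub>R\<^esub> \<odot>\<^bsub>T\<^esub> pure \<zero>\<^bsub>U\<^esub> \<zero>\<^bsub>V\<^esub>)"
      by (intro smult pure pure_closed) auto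
    then have "Q \<zero>\<^bsub>T\<^esub>"
      by (simp add: pure_closed)
    then show ?case
      using K.quotient_zero by (simp add: tensor_product_def flip: tensor_free_def)
  next
    case (gen p)
    then show ?case
      using pure[of "fst p" "snd p"] by (auto simp: pure_tensor_def tensor_gen_def tensor_free_def)
  next
    case (add g h)
    then show ?case
      using assms(3)[of "?coset g" "?coset h"] closed[of g] closed[of h]
      by (simp add: tensor_product_def K.quotient_add flip: tensor_free_def)
  next
    case (smult c g)
    then show ?case
      using assms(4)[of c "?coset g"] closed[of g]
      by (simp add: tensor_product_def K.quotient_smult flip: tensor_free_def)
  qed
  with tv show ?thesis by simp
qed

lemma tensor_hom_unique:
  assumes f: "f \<in> module_hom R T W" and g: "g \<in> module_hom R T W"
    and eq: "\<And>x y. \<lbrakk>x \<in> carrier U; y \<in> carrier V\<rbrakk> \<Longrightarrow> f (pure x y) = g (pure x y)"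
    and t: "t \<in> carrier T"
  shows "f t = g t"
  using t by (induction rule: tensor_induct)
    (simp_all add: eq module_hom_add[OF f] module_hom_add[OF g] module_hom_smult[OF f] module_hom_smult[OF g])

section \<open>Lifts of multilinear maps in one, two and three tensor arguments\<close>

definition tensor_lift :: "('f, 'c, 'k) module_scheme \<Rightarrow> ('a \<Rightarrow> 'b \<Rightarrow> 'c) \<Rightarrow> ('a \<times> 'b \<Rightarrow> 'f) set \<Rightarrow> 'c" where
  "tensor_lift W b = quotient_lift (free_lift R (carrier U \<times> carrier V) W (case_prod b))"

text \<open>The linear extension of \<open>b\<close> to the free module has a submodule as kernel.
  Bilinearity puts every relation into it, hence also their span, and the extension descends to the
  quotient.\<close>

lemma tensor_lift:
  assumes W: "module R W" and b: "bilinear_map R U V W b"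
  shows tensor_lift_hom: "tensor_lift W b \<in> module_hom R T W"
    and tensor_lift_pure: "\<And>x y. \<lbrakk>x \<in> carrier U; y \<in> carrier V\<rbrakk> \<Longrightarrow> tensor_lift W b (pure x y) = b x y"
proof -
  let ?X = "carrier U \<times> carrier V"
  let ?f = "free_lift R ?X W (case_prod b)"
  interpret W: module R W by fact
  have bX: "case_prod b \<in> ?X \<rightarrow> carrier W"
    using bilinear_map_closed[OF b] by auto
  have f: "?f \<in> module_hom R (tensor_free R U V) W"
    unfolding tensor_free_def by (rule W.free_lift_hom[OF bX])
  interpret f: mod_hom R "tensor_free R U V" W ?f
    using f by unfold_locales
  have gen: "?f (tensor_gen R U V x y) = b x y" if "x \<in> carrier U" "y \<in> carrier V" for x y
    unfolding tensor_gen_def using W.free_lift_generator[OF bX] that by simp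
  note b_simps = module_hom_add[OF bilinear_mapD(1)[OF b]] module_hom_add[OF bilinear_mapD(2)[OF b]]
    module_hom_smult[OF bilinear_mapD(1)[OF b]] module_hom_smult[OF bilinear_mapD(2)[OF b]]
    bilinear_map_closed[OF b]
  have "tensor_relations R U V \<subseteq> f.ker"
    by (auto simp: tensor_relations_def Let_def f.ker_def tensor_gen_closed gen b_simps)
  then have "tensor_kernel R U V \<subseteq> f.ker"
    unfolding tensor_kernel_def by (rule P.span_is_subset[OF _ f.ker_is_submodule])
  then have ker: "?f v = \<zero>\<^bsub>W\<^esub>" if "v \<in> tensor_kernel R U V" for v
    using that by (auto simp: f.ker_def)
  show "tensor_lift W b \<in> module_hom R T W"
    unfolding tensor_lift_def tensor_product_def by (rule K.quotient_lift_hom[OF W f ker])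
  show "tensor_lift W b (pure x y) = b x y" if "x \<in> carrier U" "y \<in> carrier V" for x y
    using K.quotient_lift_coset[OF W f ker tensor_gen_closed] gen[OF that]
    by (simp add: tensor_lift_def pure_tensor_def)
qed

text \<open>Linearity in a parameter is what makes iterated lifts multilinear.\<close>

lemma tensor_lift_param:
  assumes W: "module R W" and Z: "module R Z"
    and b: "\<And>z. z \<in> carrier Z \<Longrightarrow> bilinear_map R U V W (b z)"
    and bz: "\<And>x y. \<lbrakk>x \<in> carrier U; y \<in> carrier V\<rbrakk> \<Longrightarrow> (\<lambda>z. b z x y) \<in> module_hom R Z W"
    and t: "t \<in> carrier T"
  shows "(\<lambda>z. tensor_lift W (b z) t) \<in> module_hom R Z W"
  using t
proof (induction rule: tensor_induct)
  case (pure x y)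
  then show ?case
    by (intro module_hom_cong[OF bz _ Z]) (simp_all add: tensor_lift_pure[OF W b])
next
  case (add s t)
  then show ?case
    by (intro module_hom_cong[OF module.module_hom_plus[OF W add.IH] _ Z])
      (simp add: module_hom_add[OF tensor_lift_hom[OF W b]])
next
  case (smult c t)
  then show ?case
    by (intro module_hom_cong[OF module.module_hom_scale[OF W smult.IH] _ Z])
      (simp_all add: module_hom_smult[OF tensor_lift_hom[OF W b]])
qed

text \<open>Curried form: with a pair from the first tensor fixed, the second tensor is lifted; the
  result is bilinear in that pair and is lifted again.\<close>

definition tensor_lift2 ::
  "('f, 'c, 'k) module_scheme \<Rightarrow> ('a \<Rightarrow> 'b \<Rightarrow> 'a \<Rightarrow> 'b \<Rightarrow> 'c) \<Rightarrow>
   ('a \<times> 'b \<Rightarrow> 'f) set \<Rightarrow> ('a \<times> 'b \<Rightarrow> 'f) set \<Rightarrow> 'c" where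
  "tensor_lift2 W m s t = tensor_lift W (\<lambda>x y. tensor_lift W (m x y) t) s"

text \<open>Linearity in the first tensor is that of the outer lift. Linearity in the second
  combines linearity of the inner lift with \<open>tensor_lift_param\<close> for the outer
  one.\<close>

lemma tensor_lift2:
  assumes W: "module R W"
    and m1: "\<And>x2 y2. \<lbrakk>x2 \<in> carrier U; y2 \<in> carrier V\<rbrakk> \<Longrightarrow> bilinear_map R U V W (\<lambda>x1 y1. m x1 y1 x2 y2)"
    and m2: "\<And>x1 y1. \<lbrakk>x1 \<in> carrier U; y1 \<in> carrier V\<rbrakk> \<Longrightarrow> bilinear_map R U V W (m x1 y1)"
  shows tensor_lift2_inner: "\<And>t. t \<in> carrier T \<Longrightarrow> bilinear_map R U V W (\<lambda>x y. tensor_lift W (m x y) t)"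
    and tensor_lift2_bilinear: "bilinear_map R T T W (tensor_lift2 W m)"
    and tensor_lift2_pure: "\<And>x1 y1 x2 y2. \<lbrakk>x1 \<in> carrier U; y1 \<in> carrier V; x2 \<in> carrier U; y2 \<in> carrier V\<rbrakk> \<Longrightarrow>
      tensor_lift2 W m (pure x1 y1) (pure x2 y2) = m x1 y1 x2 y2"
proof -
  show inner: "bilinear_map R U V W (\<lambda>x y. tensor_lift W (m x y) t)" if t: "t \<in> carrier T" for t
  proof (rule bilinear_mapI)
    fix y assume y: "y \<in> carrier V"
    show "(\<lambda>x. tensor_lift W (m x y) t) \<in> module_hom R U W"
      by (rule tensor_lift_param[OF W U.module_axioms _ _ t]) (use y in \<open>auto intro: m2 bilinear_mapD(1)[OF m1]\<close>)
  next
    fix x assume x: "x \<in> carrier U"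
    show "(\<lambda>y. tensor_lift W (m x y) t) \<in> module_hom R V W"
      by (rule tensor_lift_param[OF W V.module_axioms _ _ t]) (use x in \<open>auto intro: m2 bilinear_mapD(2)[OF m1]\<close>)
  qed
  show "bilinear_map R T T W (tensor_lift2 W m)"
    unfolding tensor_lift2_def
  proof (rule bilinear_mapI)
    fix t assume t: "t \<in> carrier T"
    show "(\<lambda>s. tensor_lift W (\<lambda>x y. tensor_lift W (m x y) t) s) \<in> module_hom R T W"
      by (rule tensor_lift_hom[OF W inner[OF t]])
    \<comment> \<open>Here \<open>s\<close> is the second tensor, acting as the parameter, and
      \<open>t\<close> is the fixed first one.\<close>
    show "(\<lambda>s. tensor_lift W (\<lambda>x y. tensor_lift W (m x y) s) t) \<in> module_hom R T W"
      by (rule tensor_lift_param[OF W T.module_axioms inner tensor_lift_hom[OF W m2] t])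
  qed
  show "tensor_lift2 W m (pure x1 y1) (pure x2 y2) = m x1 y1 x2 y2"
    if "x1 \<in> carrier U" "y1 \<in> carrier V" "x2 \<in> carrier U" "y2 \<in> carrier V" for x1 y1 x2 y2
    unfolding tensor_lift2_def using that by (simp add: tensor_lift_pure[OF W] inner pure_closed m2)
qed

text \<open>Two nested uses of \<open>tensor_lift_param\<close>. In the threefold lift the parameter
  is a component of the first tensor, so \<open>Z\<close> becomes \<open>U\<close> or
  \<open>V\<close>.\<close>

lemma tensor_lift2_param:
  assumes W: "module R W" and Z: "module R Z"
    and m1: "\<And>z x2 y2. \<lbrakk>z \<in> carrier Z; x2 \<in> carrier U; y2 \<in> carrier V\<rbrakk> \<Longrightarrow>
      bilinear_map R U V W (\<lambda>x1 y1. m z x1 y1 x2 y2)"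
    and m2: "\<And>z x1 y1. \<lbrakk>z \<in> carrier Z; x1 \<in> carrier U; y1 \<in> carrier V\<rbrakk> \<Longrightarrow> bilinear_map R U V W (m z x1 y1)"
    and mz: "\<And>x1 y1 x2 y2. \<lbrakk>x1 \<in> carrier U; y1 \<in> carrier V; x2 \<in> carrier U; y2 \<in> carrier V\<rbrakk> \<Longrightarrow>
      (\<lambda>z. m z x1 y1 x2 y2) \<in> module_hom R Z W"
    and s: "s \<in> carrier T" and t: "t \<in> carrier T"
  shows "(\<lambda>z. tensor_lift2 W (m z) s t) \<in> module_hom R Z W"
  unfolding tensor_lift2_def
proof (rule tensor_lift_param[OF W Z _ _ s])
  show "bilinear_map R U V W (\<lambda>x y. tensor_lift W (m z x y) t)" if "z \<in> carrier Z" for z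
    by (rule tensor_lift2_inner[OF W m1[OF that] m2[OF that] t])
  show "(\<lambda>z. tensor_lift W (m z x y) t) \<in> module_hom R Z W" if "x \<in> carrier U" "y \<in> carrier V" for x y
    by (rule tensor_lift_param[OF W Z m2[OF _ that] mz[OF that] t])
qed

definition tensor_lift3 ::
  "('f, 'c, 'k) module_scheme \<Rightarrow> ('a \<Rightarrow> 'b \<Rightarrow> 'a \<Rightarrow> 'b \<Rightarrow> 'a \<Rightarrow> 'b \<Rightarrow> 'c) \<Rightarrow>
   ('a \<times> 'b \<Rightarrow> 'f) set \<Rightarrow> ('a \<times> 'b \<Rightarrow> 'f) set \<Rightarrow> ('a \<times> 'b \<Rightarrow> 'f) set \<Rightarrow> 'c" where
  "tensor_lift3 W m s t u = tensor_lift W (\<lambda>x y. tensor_lift2 W (m x y) t u) s"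

text \<open>The first tensor is the outer lift. The other two enter as parameters, and their
  linearity is inherited from the bilinear inner \<open>tensor_lift2\<close>.\<close>

lemma tensor_lift3:
  assumes W: "module R W"
    and m1: "\<And>x2 y2 x3 y3. \<lbrakk>x2 \<in> carrier U; y2 \<in> carrier V; x3 \<in> carrier U; y3 \<in> carrier V\<rbrakk> \<Longrightarrow>
      bilinear_map R U V W (\<lambda>x1 y1. m x1 y1 x2 y2 x3 y3)"
    and m2: "\<And>x1 y1 x3 y3. \<lbrakk>x1 \<in> carrier U; y1 \<in> carrier V; x3 \<in> carrier U; y3 \<in> carrier V\<rbrakk> \<Longrightarrow>
      bilinear_map R U V W (\<lambda>x2 y2. m x1 y1 x2 y2 x3 y3)"
    and m3: "\<And>x1 y1 x2 y2. \<lbrakk>x1 \<in> carrier U; y1 \<in> carrier V; x2 \<in> carrier U; y2 \<in> carrier V\<rbrakk> \<Longrightarrow>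
      bilinear_map R U V W (m x1 y1 x2 y2)"
  shows tensor_lift3_trilinear: "trilinear_map R T T T W (tensor_lift3 W m)"
    and tensor_lift3_pure: "\<And>x1 y1 x2 y2 x3 y3.
      \<lbrakk>x1 \<in> carrier U; y1 \<in> carrier V; x2 \<in> carrier U; y2 \<in> carrier V; x3 \<in> carrier U; y3 \<in> carrier V\<rbrakk> \<Longrightarrow>
      tensor_lift3 W m (pure x1 y1) (pure x2 y2) (pure x3 y3) = m x1 y1 x2 y2 x3 y3"
proof -
  have inner: "bilinear_map R U V W (\<lambda>x y. tensor_lift2 W (m x y) t u)"
    if "t \<in> carrier T" "u \<in> carrier T" for t u
  proof (rule bilinear_mapI)
    fix y assume y: "y \<in> carrier V"
    show "(\<lambda>x. tensor_lift2 W (m x y) t u) \<in> module_hom R U W"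
      by (rule tensor_lift2_param[OF W U.module_axioms _ _ _ that])
        (use y in \<open>auto intro: m2 m3 bilinear_mapD(1)[OF m1]\<close>)
  next
    fix x assume x: "x \<in> carrier U"
    show "(\<lambda>y. tensor_lift2 W (m x y) t u) \<in> module_hom R V W"
      by (rule tensor_lift2_param[OF W V.module_axioms _ _ _ that])
        (use x in \<open>auto intro: m2 m3 bilinear_mapD(2)[OF m1]\<close>)
  qed
  have lift2: "bilinear_map R T T W (tensor_lift2 W (m x y))"
    if "x \<in> carrier U" "y \<in> carrier V" for x y
    by (rule tensor_lift2_bilinear[OF W m2[OF that] m3[OF that]])
  show "trilinear_map R T T T W (tensor_lift3 W m)"
    unfolding tensor_lift3_def
  proof (rule trilinear_mapI)
    fix s t assume s: "s \<in> carrier T" and t: "t \<in> carrier T"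
    show "(\<lambda>u. tensor_lift W (\<lambda>x y. tensor_lift2 W (m x y) s t) u) \<in> module_hom R T W"
      by (rule tensor_lift_hom[OF W inner[OF s t]])
    show "(\<lambda>u. tensor_lift W (\<lambda>x y. tensor_lift2 W (m x y) u t) s) \<in> module_hom R T W"
      by (rule tensor_lift_param[OF W T.module_axioms inner[OF _ t] bilinear_mapD(1)[OF lift2 t] s])
    show "(\<lambda>u. tensor_lift W (\<lambda>x y. tensor_lift2 W (m x y) t u) s) \<in> module_hom R T W"
      by (rule tensor_lift_param[OF W T.module_axioms inner[OF t] bilinear_mapD(2)[OF lift2 t] s])
  qed
  show "tensor_lift3 W m (pure x1 y1) (pure x2 y2) (pure x3 y3) = m x1 y1 x2 y2 x3 y3"
    if "x1 \<in> carrier U" "y1 \<in> carrier V" "x2 \<in> carrier U" "y2 \<in> carrier V" "x3 \<in> carrier U" "y3 \<in> carrier V"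
    for x1 y1 x2 y2 x3 y3
    unfolding tensor_lift3_def using that
    by (simp add: tensor_lift_pure[OF W] inner pure_closed tensor_lift2_pure[OF W] m2 m3)
qed

section \<open>Multilinear maps agreeing on pure tensors\<close>

lemma tensor_bilinear_unique:
  assumes f: "bilinear_map R T T W f" and g: "bilinear_map R T T W g"
    and eq: "\<And>x1 y1 x2 y2. \<lbrakk>x1 \<in> carrier U; y1 \<in> carrier V; x2 \<in> carrier U; y2 \<in> carrier V\<rbrakk> \<Longrightarrow>
      f (pure x1 y1) (pure x2 y2) = g (pure x1 y1) (pure x2 y2)"
    and s: "s \<in> carrier T" and t: "t \<in> carrier T"
  shows "f s t = g s t"
proof (rule tensor_hom_unique[OF bilinear_mapD(1)[OF f t] bilinear_mapD(1)[OF g t] _ s])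
  fix x y assume xy: "x \<in> carrier U" "y \<in> carrier V"
  show "f (pure x y) t = g (pure x y) t"
    by (rule tensor_hom_unique[OF bilinear_mapD(2)[OF f pure_closed] bilinear_mapD(2)[OF g pure_closed]
          eq[OF xy] t])
qed

lemma tensor_trilinear_unique:
  assumes f: "trilinear_map R T T T W f" and g: "trilinear_map R T T T W g"
    and eq: "\<And>x1 y1 x2 y2 x3 y3.
      \<lbrakk>x1 \<in> carrier U; y1 \<in> carrier V; x2 \<in> carrier U; y2 \<in> carrier V; x3 \<in> carrier U; y3 \<in> carrier V\<rbrakk> \<Longrightarrow>
      f (pure x1 y1) (pure x2 y2) (pure x3 y3) = g (pure x1 y1) (pure x2 y2) (pure x3 y3)"
    and s: "s \<in> carrier T" and t: "t \<in> carrier T" and u: "u \<in> carrier T"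
  shows "f s t u = g s t u"
proof (rule tensor_hom_unique[OF trilinear_mapD(1)[OF f t u] trilinear_mapD(1)[OF g t u] _ s])
  fix x y assume xy: "x \<in> carrier U" "y \<in> carrier V"
  \<comment> \<open>Freezing the first slot at a pure tensor leaves a problem in two
    arguments.\<close>
  have "bilinear_map R T T W (f (pure x y))" "bilinear_map R T T W (g (pure x y))"
    using trilinear_mapD(2,3)[OF f] trilinear_mapD(2,3)[OF g] pure_closed by (simp_all add: bilinear_map_def)
  then show "f (pure x y) t u = g (pure x y) t u"
    by (rule tensor_bilinear_unique[OF _ _ _ t u]) (rule eq[OF xy])
qed

end


section \<open>Poisson 3-Lie algebra structure on the tensor product\<close>

locale poisson_tensor_algebra =
  A1: poisson_three_lie_algebra F A1 mul1 br1 + A2: comm_assoc_algebra F A2 mul2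
  for F :: "('f, 'r) ring_scheme" and A1 :: "('f, 'a, 'm) module_scheme" and A2 :: "('f, 'b, 'n) module_scheme"
    and mul1 br1 mul2
begin

sublocale module_pair F A1 A2
  by (intro module_pair.intro A1.module_axioms A2.module_axioms)

lemmas mul1_closed = bilinear_map_closed[OF A1.mul_bilinear]
lemmas br1_closed = trilinear_map_closed[OF A1.br_trilinear]
lemmas mul2_closed = bilinear_map_closed[OF A2.mul_bilinear]
lemmas mul2_homs = bilinear_mapD[OF A2.mul_bilinear] bilinear_map_homs[OF A2.mul_bilinear]

text \<open>Together with commutativity and associativity this gives ordered rewriting a normal form
  for products in \<open>A2\<close>, by which second factors are recognised as equal.\<close>

lemma mul2_left_comm:
  assumes "x \<in> carrier A2" "y \<in> carrier A2" "z \<in> carrier A2"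
  shows "mul2 x (mul2 y z) = mul2 y (mul2 x z)"
  using assms A2.mul_assoc[of x y z] A2.mul_assoc[of y x z] A2.mul_comm[of x y] by simp

lemmas mul2_ac = A2.mul_assoc A2.mul_comm mul2_left_comm

section \<open>The two operations and their values on pure tensors\<close>

definition "tensor_mul = tensor_lift2 T (\<lambda>x1 y1 x2 y2. pure (mul1 x1 x2) (mul2 y1 y2))"

definition "tensor_br =
  tensor_lift3 T (\<lambda>x1 y1 x2 y2 x3 y3. pure (br1 x1 x2 x3) (mul2 (mul2 y1 y2) y3))"

lemma tensor_mul:
  shows tensor_mul_bilinear: "bilinear_map F T T T tensor_mul"
    and tensor_mul_pure: "\<And>x1 y1 x2 y2.
      \<lbrakk>x1 \<in> carrier A1; y1 \<in> carrier A2; x2 \<in> carrier A1; y2 \<in> carrier A2\<rbrakk> \<Longrightarrow>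
      tensor_mul (pure x1 y1) (pure x2 y2) = pure (mul1 x1 x2) (mul2 y1 y2)"
proof -
  have 1: "bilinear_map F A1 A2 T (\<lambda>x1 y1. pure (mul1 x1 x2) (mul2 y1 y2))"
    \<comment> \<open>The bound pair now occupies the second slot, and \<open>x2\<close>,
      \<open>y2\<close> are the fixed entries of the first.\<close>
    and 2: "bilinear_map F A1 A2 T (\<lambda>x1 y1. pure (mul1 x2 x1) (mul2 y2 y1))"
    if "x2 \<in> carrier A1" "y2 \<in> carrier A2" for x2 y2
    using that bilinear_mapD[OF A1.mul_bilinear] mul2_homs(1,2)
    by (auto intro!: bilinear_map_comp[OF pure_bilinear])
  show "bilinear_map F T T T tensor_mul"
    unfolding tensor_mul_def by (rule tensor_lift2_bilinear[OF T.module_axioms 1 2])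
  show "tensor_mul (pure x1 y1) (pure x2 y2) = pure (mul1 x1 x2) (mul2 y1 y2)"
    if "x1 \<in> carrier A1" "y1 \<in> carrier A2" "x2 \<in> carrier A1" "y2 \<in> carrier A2" for x1 y1 x2 y2
    unfolding tensor_mul_def by (rule tensor_lift2_pure[OF T.module_axioms 1 2 that])
qed

lemma tensor_br:
  shows tensor_br_trilinear: "trilinear_map F T T T T tensor_br"
    and tensor_br_pure: "\<And>x1 y1 x2 y2 x3 y3.
      \<lbrakk>x1 \<in> carrier A1; y1 \<in> carrier A2; x2 \<in> carrier A1; y2 \<in> carrier A2; x3 \<in> carrier A1; y3 \<in> carrier A2\<rbrakk> \<Longrightarrow>
      tensor_br (pure x1 y1) (pure x2 y2) (pure x3 y3) = pure (br1 x1 x2 x3) (mul2 (mul2 y1 y2) y3)"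
proof -
  \<comment> \<open>One statement per slot: \<open>pure\<close> is composed with a linear map on
    \<open>A1\<close> and one on \<open>A2\<close>, the bound pair moving from the first slot to the
    third.\<close>
  have 1: "bilinear_map F A1 A2 T (\<lambda>x1 y1. pure (br1 x1 x2 x3) (mul2 (mul2 y1 y2) y3))"
    and 2: "bilinear_map F A1 A2 T (\<lambda>x1 y1. pure (br1 x2 x1 x3) (mul2 (mul2 y2 y1) y3))"
    and 3: "bilinear_map F A1 A2 T (\<lambda>x1 y1. pure (br1 x2 x3 x1) (mul2 (mul2 y2 y3) y1))"
    if "x2 \<in> carrier A1" "y2 \<in> carrier A2" "x3 \<in> carrier A1" "y3 \<in> carrier A2" for x2 y2 x3 y3
    by (rule bilinear_map_comp[OF pure_bilinear trilinear_mapD(1)[OF A1.br_trilinear that(1,3)]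
          mul2_homs(3)[OF mul2_homs(1)[OF that(2)] that(4)]]
        bilinear_map_comp[OF pure_bilinear trilinear_mapD(2)[OF A1.br_trilinear that(1,3)]
          mul2_homs(3)[OF mul2_homs(2)[OF that(2)] that(4)]]
        bilinear_map_comp[OF pure_bilinear trilinear_mapD(3)[OF A1.br_trilinear that(1,3)]
          mul2_homs(2)[OF mul2_closed[OF that(2,4)]]])+
  show "trilinear_map F T T T T tensor_br"
    unfolding tensor_br_def by (rule tensor_lift3_trilinear[OF T.module_axioms 1 2 3])
  show "tensor_br (pure x1 y1) (pure x2 y2) (pure x3 y3) = pure (br1 x1 x2 x3) (mul2 (mul2 y1 y2) y3)"
    if "x1 \<in> carrier A1" "y1 \<in> carrier A2" "x2 \<in> carrier A1" "y2 \<in> carrier A2" "x3 \<in> carrier A1" "y3 \<in> carrier A2"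
    for x1 y1 x2 y2 x3 y3
    unfolding tensor_br_def by (rule tensor_lift3_pure[OF T.module_axioms 1 2 3 that])
qed

lemmas mul_homs = bilinear_map_homs[OF tensor_mul_bilinear]
lemmas br_homs = trilinear_map_homs[OF tensor_br_trilinear]
lemmas mul_closed = bilinear_map_closed[OF tensor_mul_bilinear]
lemmas br_closed = trilinear_map_closed[OF tensor_br_trilinear]
lemmas homs = module_hom_ident mul_homs br_homs T.module_hom_plus T.module_hom_minus
lemmas closed = pure_closed mul_closed br_closed T.M.a_closed T.M.a_inv_closed
lemmas pures = tensor_mul_pure tensor_br_pure mul1_closed br1_closed mul2_closed

text \<open>Negation is scaling by minus one. This carries the signs of skew-symmetry from
  \<open>A1\<close> to \<open>T\<close>.\<close>

lemma pure_minus_left: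
  assumes "x \<in> carrier A1" "y \<in> carrier A2"
  shows "pure (\<ominus>\<^bsub>A1\<^esub> x) y = \<ominus>\<^bsub>T\<^esub> pure x y"
  using assms pure_smult(1)[of y "\<ominus>\<^bsub>F\<^esub> \<one>\<^bsub>F\<^esub>" x]
  by (simp add: A1.smult_minus_1 T.smult_minus_1 pure_closed)

section \<open>The axioms on the tensor product\<close>

lemma tensor_mul_comm:
  assumes "s \<in> carrier T" "t \<in> carrier T"
  shows "tensor_mul s t = tensor_mul t s"
proof (rule tensor_bilinear_unique[where W = T and f = tensor_mul and g = "\<lambda>s t. tensor_mul t s",
      OF _ _ _ assms])
  show "bilinear_map F T T T tensor_mul" "bilinear_map F T T T (\<lambda>s t. tensor_mul t s)"
    using tensor_mul_bilinear by (auto simp: bilinear_map_def)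
qed (simp add: pures A1.mul_comm A2.mul_comm)

lemma tensor_mul_assoc:
  assumes s: "s \<in> carrier T" and t: "t \<in> carrier T" and u: "u \<in> carrier T"
  shows "tensor_mul (tensor_mul s t) u = tensor_mul s (tensor_mul t u)"
proof (rule tensor_trilinear_unique[where W = T and f = "\<lambda>s t u. tensor_mul (tensor_mul s t) u"
      and g = "\<lambda>s t u. tensor_mul s (tensor_mul t u)", OF _ _ _ s t u])
  show "trilinear_map F T T T T (\<lambda>s t u. tensor_mul (tensor_mul s t) u)"
    "trilinear_map F T T T T (\<lambda>s t u. tensor_mul s (tensor_mul t u))"
    \<comment> \<open>Each argument occurs exactly once, so linearity in it follows by descending
      through the expression to the identity map, with \<open>closed\<close> handling the other
      slots.\<close>
    by (rule trilinear_mapI; intro homs closed; assumption)+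
qed (simp add: pures A1.mul_assoc A2.mul_assoc)

lemma tensor_br_skew12:
  assumes s: "s \<in> carrier T" and t: "t \<in> carrier T" and u: "u \<in> carrier T"
  shows "tensor_br t s u = \<ominus>\<^bsub>T\<^esub> tensor_br s t u"
proof (rule tensor_trilinear_unique[where W = T and f = "\<lambda>s t u. tensor_br t s u"
      and g = "\<lambda>s t u. \<ominus>\<^bsub>T\<^esub> tensor_br s t u", OF _ _ _ s t u])
  show "trilinear_map F T T T T (\<lambda>s t u. tensor_br t s u)"
    "trilinear_map F T T T T (\<lambda>s t u. \<ominus>\<^bsub>T\<^esub> tensor_br s t u)"
    by (rule trilinear_mapI; intro homs closed; assumption)+
next
  fix x1 y1 x2 y2 x3 y3
  assume xy: "x1 \<in> carrier A1" "y1 \<in> carrier A2" "x2 \<in> carrier A1" "y2 \<in> carrier A2"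
    "x3 \<in> carrier A1" "y3 \<in> carrier A2"
  then show "tensor_br (pure x2 y2) (pure x1 y1) (pure x3 y3) = \<ominus>\<^bsub>T\<^esub> tensor_br (pure x1 y1) (pure x2 y2) (pure x3 y3)"
    \<comment> \<open>Skew-symmetry is used at one fixed instance, since as a general rewrite rule
      it would apply to its own result. The outer sign is moved into the first factor to meet
      it.\<close>
    by (simp add: pures A1.br_skew12[OF xy(1,3,5)] mul2_ac flip: pure_minus_left)
qed

lemma tensor_br_skew23:
  assumes s: "s \<in> carrier T" and t: "t \<in> carrier T" and u: "u \<in> carrier T"
  shows "tensor_br s u t = \<ominus>\<^bsub>T\<^esub> tensor_br s t u"
proof (rule tensor_trilinear_unique[where W = T and f = "\<lambda>s t u. tensor_br s u t"
      and g = "\<lambda>s t u. \<ominus>\<^bsub>T\<^esub> tensor_br s t u", OF _ _ _ s t u])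
  show "trilinear_map F T T T T (\<lambda>s t u. tensor_br s u t)"
    "trilinear_map F T T T T (\<lambda>s t u. \<ominus>\<^bsub>T\<^esub> tensor_br s t u)"
    by (rule trilinear_mapI; intro homs closed; assumption)+
next
  fix x1 y1 x2 y2 x3 y3
  assume xy: "x1 \<in> carrier A1" "y1 \<in> carrier A2" "x2 \<in> carrier A1" "y2 \<in> carrier A2"
    "x3 \<in> carrier A1" "y3 \<in> carrier A2"
  then show "tensor_br (pure x1 y1) (pure x3 y3) (pure x2 y2) = \<ominus>\<^bsub>T\<^esub> tensor_br (pure x1 y1) (pure x2 y2) (pure x3 y3)"
    by (simp add: pures A1.br_skew23[OF xy(1,3,5)] mul2_ac flip: pure_minus_left)
qed

text \<open>Both sides are linear in \<open>s\<close>, which reduces \<open>s\<close> to a pure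
  tensor while the others stay arbitrary; what remains is an identity of trilinear maps.\<close>

lemma tensor_leibniz:
  assumes s: "s \<in> carrier T" and t: "t \<in> carrier T" and u: "u \<in> carrier T" and v: "v \<in> carrier T"
  shows "tensor_br (tensor_mul s t) u v =
    tensor_mul s (tensor_br t u v) \<oplus>\<^bsub>T\<^esub> tensor_mul t (tensor_br s u v)"
proof (rule tensor_hom_unique[where W = T and f = "\<lambda>s. tensor_br (tensor_mul s t) u v"
      and g = "\<lambda>s. tensor_mul s (tensor_br t u v) \<oplus>\<^bsub>T\<^esub> tensor_mul t (tensor_br s u v)",
      OF _ _ _ s])
  fix x y assume xy: "x \<in> carrier A1" "y \<in> carrier A2"
  show "tensor_br (tensor_mul (pure x y) t) u v =
    tensor_mul (pure x y) (tensor_br t u v) \<oplus>\<^bsub>T\<^esub> tensor_mul t (tensor_br (pure x y) u v)"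
  proof (rule tensor_trilinear_unique[where W = T and f = "\<lambda>t u v. tensor_br (tensor_mul (pure x y) t) u v"
        and g = "\<lambda>t u v. tensor_mul (pure x y) (tensor_br t u v) \<oplus>\<^bsub>T\<^esub> tensor_mul t (tensor_br (pure x y) u v)",
        OF _ _ _ t u v])
    show "trilinear_map F T T T T (\<lambda>t u v. tensor_br (tensor_mul (pure x y) t) u v)"
      "trilinear_map F T T T T
        (\<lambda>t u v. tensor_mul (pure x y) (tensor_br t u v) \<oplus>\<^bsub>T\<^esub> tensor_mul t (tensor_br (pure x y) u v))"
      by (rule trilinear_mapI; intro homs closed; assumption)+
  \<comment> \<open>The rule in \<open>A1\<close> turns the first factor on the left into a sum, and
    \<open>pure_add\<close> splits it into the two terms on the right.\<close>
  qed (use xy in \<open>simp add: pures A1.leibniz pure_add mul2_ac\<close>)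
qed (intro homs closed t u v)+

text \<open>Bilinearity in \<open>t1\<close>, \<open>t2\<close> reduces these to pure tensors for
  arbitrary \<open>t3\<close>, \<open>t4\<close>, \<open>t5\<close>; then both sides are trilinear
  in the latter.\<close>

lemma tensor_fundamental_identity:
  assumes t1: "t1 \<in> carrier T" and t2: "t2 \<in> carrier T" and t3: "t3 \<in> carrier T"
    and t4: "t4 \<in> carrier T" and t5: "t5 \<in> carrier T"
  shows "tensor_br t1 t2 (tensor_br t3 t4 t5) =
    tensor_br (tensor_br t1 t2 t3) t4 t5 \<oplus>\<^bsub>T\<^esub> tensor_br t3 (tensor_br t1 t2 t4) t5 \<oplus>\<^bsub>T\<^esub>
    tensor_br t3 t4 (tensor_br t1 t2 t5)"
proof (rule tensor_bilinear_unique[where W = T and f = "\<lambda>t1 t2. tensor_br t1 t2 (tensor_br t3 t4 t5)"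
      and g = "\<lambda>t1 t2. tensor_br (tensor_br t1 t2 t3) t4 t5 \<oplus>\<^bsub>T\<^esub> tensor_br t3 (tensor_br t1 t2 t4) t5 \<oplus>\<^bsub>T\<^esub>
        tensor_br t3 t4 (tensor_br t1 t2 t5)", OF _ _ _ t1 t2])
  fix x1 y1 x2 y2
  assume xy: "x1 \<in> carrier A1" "y1 \<in> carrier A2" "x2 \<in> carrier A1" "y2 \<in> carrier A2"
  let ?f = "\<lambda>t3 t4 t5. tensor_br (pure x1 y1) (pure x2 y2) (tensor_br t3 t4 t5)"
  let ?g = "\<lambda>t3 t4 t5. tensor_br (tensor_br (pure x1 y1) (pure x2 y2) t3) t4 t5 \<oplus>\<^bsub>T\<^esub>
    tensor_br t3 (tensor_br (pure x1 y1) (pure x2 y2) t4) t5 \<oplus>\<^bsub>T\<^esub>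
    tensor_br t3 t4 (tensor_br (pure x1 y1) (pure x2 y2) t5)"
  show "?f t3 t4 t5 = ?g t3 t4 t5"
  proof (rule tensor_trilinear_unique[where W = T and f = ?f and g = ?g, OF _ _ _ t3 t4 t5])
    show "trilinear_map F T T T T ?f" "trilinear_map F T T T T ?g"
      by (rule trilinear_mapI; intro homs closed; assumption)+
  next
    fix x3 y3 x4 y4 x5 y5
    assume xy': "x3 \<in> carrier A1" "y3 \<in> carrier A2" "x4 \<in> carrier A1" "y4 \<in> carrier A2"
      "x5 \<in> carrier A1" "y5 \<in> carrier A2"
    show "?f (pure x3 y3) (pure x4 y4) (pure x5 y5) = ?g (pure x3 y3) (pure x4 y4) (pure x5 y5)"
      \<comment> \<open>The identity is instantiated because its last summand again has the shape of
        its left side, so the general rule would not terminate.\<close>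
      using xy xy' by (simp add: pures A1.fundamental_identity[OF xy(1,3) xy'(1,3,5)] pure_add mul2_ac)
  qed
qed (rule bilinear_mapI; intro homs closed t3 t4 t5; assumption)+

lemma is_tensor_mult: "is_tensor_mult F A1 A2 mul1 mul2 tensor_mul"
  by (simp add: is_tensor_mult_def tensor_mul)

lemma is_tensor_bracket: "is_tensor_bracket F A1 A2 br1 mul2 tensor_br"
  by (simp add: is_tensor_bracket_def tensor_br)

text \<open>Bilinearity leaves values off the carrier free, so agreement is claimed only for
  arguments in \<open>carrier T\<close>.\<close>

lemma is_tensor_mult_unique:
  assumes "is_tensor_mult F A1 A2 mul1 mul2 mul" "s \<in> carrier T" "t \<in> carrier T"
  shows "mul s t = tensor_mul s t"
  by (rule tensor_bilinear_unique[OF _ tensor_mul_bilinear _ assms(2,3), of mul])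
    (use assms(1) in \<open>simp_all only: is_tensor_mult_def tensor_mul_pure\<close>)

lemma is_tensor_bracket_unique:
  assumes "is_tensor_bracket F A1 A2 br1 mul2 br" "s \<in> carrier T" "t \<in> carrier T" "u \<in> carrier T"
  shows "br s t u = tensor_br s t u"
  by (rule tensor_trilinear_unique[OF _ tensor_br_trilinear _ assms(2,3,4), of br])
    (use assms(1) in \<open>simp_all only: is_tensor_bracket_def tensor_br_pure\<close>)

lemma poisson_tensor: "poisson_three_lie_algebra F T tensor_mul tensor_br"
proof -
  have vs: "vectorspace F T"
    by (intro vectorspace.intro T.module_axioms A1.field_axioms)
  have "comm_assoc_algebra F T tensor_mul"
    by (rule comm_assoc_algebra.intro[OF vs comm_assoc_algebra_axioms.intro[OF tensor_mul_bilinear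
          tensor_mul_comm tensor_mul_assoc]])
  moreover have "three_lie_algebra F T tensor_br"
    by (rule three_lie_algebra.intro[OF vs three_lie_algebra_axioms.intro[OF tensor_br_trilinear
          tensor_br_skew12 tensor_br_skew23 tensor_fundamental_identity]])
  ultimately show ?thesis
    by (rule poisson_three_lie_algebra.intro[OF _ _ poisson_three_lie_algebra_axioms.intro])
      (rule tensor_leibniz)
qed

end

theorem proposition3p2:
  fixes F :: "('f, 'r) ring_scheme"
    and A1 :: "('f, 'a, 'm) module_scheme"
    and A2 :: "('f, 'b, 'n) module_scheme"
    and mul1 :: "'a \<Rightarrow> 'a \<Rightarrow> 'a"
    and br1 :: "'a \<Rightarrow> 'a \<Rightarrow> 'a \<Rightarrow> 'a"
    and mul2 :: "'b \<Rightarrow> 'b \<Rightarrow> 'b"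
  assumes "field F"
    and "char_zero F"
    and "poisson_three_lie_algebra F A1 mul1 br1"
    and "vectorspace.fin_dim F A1"
    and "comm_assoc_algebra F A2 mul2"
    and "vectorspace.fin_dim F A2"
  shows "\<exists>mul br.
    is_tensor_mult F A1 A2 mul1 mul2 mul \<and>
    is_tensor_bracket F A1 A2 br1 mul2 br \<and>
    (\<forall>mul'. is_tensor_mult F A1 A2 mul1 mul2 mul' \<longrightarrow>
       (\<forall>s\<in>carrier (tensor_product F A1 A2). \<forall>t\<in>carrier (tensor_product F A1 A2).
          mul' s t = mul s t)) \<and>
    (\<forall>br'. is_tensor_bracket F A1 A2 br1 mul2 br' \<longrightarrow>
       (\<forall>s\<in>carrier (tensor_product F A1 A2). \<forall>t\<in>carrier (tensor_product F A1 A2).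
        \<forall>u\<in>carrier (tensor_product F A1 A2). br' s t u = br s t u)) \<and>
    poisson_three_lie_algebra F (tensor_product F A1 A2) mul br"
proof -
  interpret poisson_tensor_algebra F A1 A2 mul1 br1 mul2
    using assms by (intro poisson_tensor_algebra.intro)
  show ?thesis
    by (intro exI[of _ tensor_mul] exI[of _ tensor_br] conjI allI impI ballI
        is_tensor_mult is_tensor_bracket poisson_tensor)
      (rule is_tensor_mult_unique is_tensor_bracket_unique; assumption)+
qed

end
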